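(* Let $s\ge0$ be an integer, let $p_s(n)$ be the label of the $n$-th leaf of the infinite labelled tree $\mathcal{F}_s$, and let $r_1,r_2,\ldots$ be the ruler sequence. For all $n\ge1$, \[ p_s(n+1)-p_s(n) = r_n + s\,[\![ n \text{ is a power of } 2 ]\!], \] where $[\![P]\!]$ is $1$ if the proposition $P$ is true and $0$ if it is false (and $1=2^0$ counts as a power of $2$).
   Context: For an integer $s \ge 0$, the infinite tree $\mathcal{F}_s$ is built as follows. It contains an initial single-node tree (one leaf); for each $h \ge 1$ a complete binary tree with $2^h-1$ nodes, called subtree $h$ (so the trees have sizes $1,1,3,7,15,\ldots$); and for each $h\ge 1$ a super-node $y_h$ consisting of $s$ ordinary nodes (no labelled nodes at all if $s=0$). The right child of $y_h$ is the root of subtree $h$; the left child of $y_h$ is $y_{h-1}$ if $h \ge 2$, and is the initial single-node tree if $h=1$. Labels $1,2,3,\ldots$ are given to the nodes in the following order: the initial single node, the $s$ nodes of $y_1$, the nodes of subtree $1$ in preorder, the $s$ nodes of $y_2$, the nodes of subtree $2$ in preorder, and so on. The leaves of $\mathcal{F}_s$ are the initial single node and the leaves of the subtrees $h\ge1$; all other nodes, including those in super-nodes, are internal. For $n\ge 1$, $d_s(n)=1$ if node $n$ is a leaf and $d_s(n)=0$ otherwise; $a_s(n)=\sum_{j=1}^n d_s(j)$; and $p_s(n)=\min\{j : a_s(j)=n\}$ is the position of the $n$-th $1$ in the sequence $d_s(1),d_s(2),\ldots$. The ruler sequence $r_1,r_2,\ldots = 1,2,1,3,1,2,1,4,1,2,1,3,1,2,1,\ldots$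 is defined by: $r_k-1$ is the exponent of the largest power of $2$ dividing $k$. *)

theory Defs
  imports "HOL-Library.Tree" "HOL-Computational_Algebra.Computational_Algebra"
begin

text \<open>
  The ordinary (labelled) nodes of the trees: \<open>Super h i\<close> is the node with index \<open>i < s\<close> inside the
  super-node \<open>y\<^sub>h\<close>, and \<open>Sub h p\<close> is the node of subtree \<open>h\<close> that is reached from the root of that
  subtree along the path \<open>p\<close> (\<open>False\<close> = left, \<open>True\<close> = right).
\<close>

datatype node = Initial | Super nat nat | Sub nat "bool list"

fun complete_tree :: "(bool list \<Rightarrow> 'a) \<Rightarrow> nat \<Rightarrow> 'a tree" where
  "complete_tree f 0 = \<langle>\<rangle>"
| "complete_tree f (Suc k) =
     \<langle>complete_tree (\<lambda>p. f (False # p)) k, f [], complete_tree (\<lambda>p. f (True # p)) k\<rangle>"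

lemma height_complete_tree [simp]: "height (complete_tree f k) = k"
  by (induction k arbitrary: f) auto

lemma complete_complete_tree [simp]: "Tree.complete (complete_tree f k)"
  by (induction k arbitrary: f) auto

lemma size_complete_tree: "size (complete_tree f k) = 2 ^ k - 1"
  using size_if_complete[of "complete_tree f k"] by simp

text \<open>
  A vertex of the tree shape carries the list of the ordinary nodes it consists of: a list with
  one element, except at a super-node, where the list has length \<open>s\<close> (and is empty if \<open>s = 0\<close>).
\<close>

definition subtree :: "nat \<Rightarrow> node list tree" where
  "subtree h = complete_tree (\<lambda>p. [Sub h p]) h"

definition supernode :: "nat \<Rightarrow> nat \<Rightarrow> node list" where
  "supernode s h = map (Super h) [0..<s]"

text \<open>
  The infinite tree has no root, because every super-node \<open>y\<^sub>h\<close> is the left child of \<open>y\<^sub>h\<^sub>+\<^sub>1\<close>. It is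
  the union of the increasing chain of the finite trees \<open>F_upto s h\<close>, where \<open>F_upto s h\<close> is the part
  that descends from \<open>y\<^sub>h\<close> (for \<open>h = 0\<close>, the initial single-node tree).
\<close>

fun F_upto :: "nat \<Rightarrow> nat \<Rightarrow> node list tree" where
  "F_upto s 0 = \<langle>\<langle>\<rangle>, [Initial], \<langle>\<rangle>\<rangle>"
| "F_upto s (Suc h) = \<langle>F_upto s h, supernode s (Suc h), subtree (Suc h)\<rangle>"

text \<open>
  The constructor \<open>\<langle>\<rangle>\<close> of the library is the empty tree, so a leaf is a node with two empty
  children. An ordinary node \<open>v\<close> inside a super-node is internal even if \<open>s = 1\<close>, since the right
  child of a super-node is never empty.
\<close>

definition is_leaf :: "nat \<Rightarrow> node \<Rightarrow> bool" where
  "is_leaf s v \<longleftrightarrow> (\<exists>h. \<langle>\<langle>\<rangle>, [v], \<langle>\<rangle>\<rangle> \<in> subtrees (F_upto s h))"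

text \<open>The nodes of \<open>F_upto s h\<close> in the order of their labels.\<close>

fun label_order :: "nat \<Rightarrow> nat \<Rightarrow> node list" where
  "label_order s 0 = [Initial]"
| "label_order s (Suc h) =
     label_order s h @ supernode s (Suc h) @ concat (preorder (subtree (Suc h)))"

lemma length_label_order: "h < length (label_order s h)"
proof (induction h)
  case (Suc h)
  have "length (concat (preorder (subtree (Suc h)))) \<ge> 1"
    by (simp add: subtree_def)
  with Suc show ?case by simp
qed simp

lemma label_order_prefix: "h \<le> k \<Longrightarrow> \<exists>vs. label_order s k = label_order s h @ vs"
  by (induction k rule: dec_induct) auto

text \<open>
  Labels start at 1. The list \<open>label_order s n\<close> has more than \<open>n\<close> elements, and every longer list of
  this kind gives the same node.
\<close>

definition labelled_node :: "nat \<Rightarrow> nat \<Rightarrow> node" where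
  "labelled_node s n = label_order s n ! (n - 1)"

lemma labelled_node_eq:
  assumes "1 \<le> n" "n \<le> length (label_order s h)"
  shows "labelled_node s n = label_order s h ! (n - 1)"
proof -
  have lt: "n - 1 < length (label_order s h)" "n - 1 < length (label_order s n)"
    using assms length_label_order[of n s] by linarith+
  have "h \<le> n \<or> n \<le> h" by linarith
  then obtain vs where "label_order s n = label_order s h @ vs \<or> label_order s h = label_order s n @ vs"
    using label_order_prefix by blast
  with lt show ?thesis by (auto simp: labelled_node_def nth_append)
qed

definition d_seq :: "nat \<Rightarrow> nat \<Rightarrow> nat" where
  "d_seq s n = (if is_leaf s (labelled_node s n) then 1 else 0)"

definition a_seq :: "nat \<Rightarrow> nat \<Rightarrow> nat" where
  "a_seq s n = (\<Sum>j = 1..n. d_seq s j)"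

definition p_seq :: "nat \<Rightarrow> nat \<Rightarrow> nat" where
  "p_seq s n = (LEAST j. 1 \<le> j \<and> a_seq s j = n)"

definition ruler :: "nat \<Rightarrow> nat" where
  "ruler k = multiplicity 2 k + 1"

end

theory Submission
  imports Defs
begin

text \<open>
  Cut the sequence of leaf indicators after every 1, so that the lengths of the blocks are the gaps
  between consecutive leaves. A complete tree of height \<open>k + 1\<close>, in preorder, has the blocks
  \<open>k + 1, r\<^sub>1, \<dots>, r\<^sub>m\<close> with \<open>m = 2\<^sup>k - 1\<close>: the root lengthens the first block of the left half
  by one, and the first block of the right half has length \<open>k + 1\<close>, which is the ruler value at
  \<open>2\<^sup>k\<close>. In the infinite tree the first block of subtree \<open>h + 1\<close> is the gap number \<open>2\<^sup>h\<close>, and the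
  super-node before it makes this gap longer by \<open>s\<close>.
\<close>

lemma ruler_power2 [simp]: "ruler (2 ^ k) = Suc k"
  by (simp add: ruler_def)

text \<open>Since \<open>i\<close> is positive and below \<open>2 ^ k\<close>, it contains fewer
  than \<open>k\<close> factors 2, and adding \<open>2 ^ k\<close> does not change that
  number.\<close>

lemma ruler_power2_add:
  assumes "0 < i" "i < 2 ^ k"
  shows "ruler (2 ^ k + i) = ruler i"
proof -
  have "\<not> 2 ^ k dvd i"
    using assms nat_dvd_not_less by blast
  then have "multiplicity 2 i < k"
    using multiplicity_dvd'[of k 2 i] by (meson not_le)
  then have "multiplicity 2 (i + 2 ^ k) = multiplicity 2 i"
    using assms by (intro multiplicity_sum_lt) auto
  then show ?thesis
    by (simp add: ruler_def add.commute)
qed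

text \<open>The sum lies strictly between the consecutive powers \<open>2 ^ k\<close> and
  \<open>2 ^ Suc k\<close>.\<close>

lemma power2_add_not_power2:
  assumes "0 < i" "i < (2::nat) ^ k"
  shows "2 ^ k + i \<noteq> 2 ^ j"
proof
  assume eq: "2 ^ k + i = 2 ^ j"
  then have "(2::nat) ^ k < 2 ^ j" "(2::nat) ^ j < 2 ^ Suc k"
    using assms by (simp_all flip: eq)
  then have "k < j" "j < Suc k"
    using nat_power_less_imp_less[OF zero_less_numeral] by blast+
  then show False by simp
qed

lemma upt_power2_Suc:
  "[1..<2 ^ Suc k] = [1..<2 ^ k] @ 2 ^ k # map ((+) (2 ^ k)) [1..<2 ^ k]"
proof -
  have "[1..<2 ^ Suc k] = [1..<2 ^ k] @ [2 ^ k..<2 ^ k + 2 ^ k]"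
    using upt_add_eq_append[of 1 "2 ^ k" "2 ^ k"] by (simp add: mult_2)
  also have "[2 ^ k..<2 ^ k + 2 ^ k] = 2 ^ k # [Suc (2 ^ k)..<2 ^ k + 2 ^ k]"
    by (simp add: upt_conv_Cons)
  also have "[Suc (2 ^ k)..<2 ^ k + 2 ^ k] = map ((+) (2 ^ k)) [1..<2 ^ k]"
    by (rule nth_equalityI) simp_all
  finally show ?thesis .
qed

text \<open>Subtraction on \<open>nat\<close> truncates, so \<open>block 0 = block 1\<close>; length
  \<open>g\<close> therefore requires \<open>g > 0\<close>.\<close>

definition block :: "nat \<Rightarrow> bool list" where
  "block g = replicate (g - 1) False @ [True]"

definition blocks :: "nat list \<Rightarrow> bool list" where
  "blocks gs = concat (map block gs)"

lemma blocks_simps [simp]: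
  "blocks [] = []" "blocks (g # gs) = block g @ blocks gs" "blocks (gs @ gs') = blocks gs @ blocks gs'"
  by (simp_all add: blocks_def)

lemma replicate_append_block: "g > 0 \<Longrightarrow> replicate m False @ block g = block (m + g)"
  by (simp add: block_def replicate_add[symmetric] flip: append_assoc)

lemma length_blocks: "\<forall>g\<in>set gs. g > 0 \<Longrightarrow> length (blocks gs) = sum_list gs"
  by (induction gs) (auto simp: block_def)

lemma count_list_blocks: "count_list (blocks gs) True = length gs"
proof (induction gs)
  case (Cons g gs)
  have "count_list (replicate m False) True = 0" for m
    by (induction m) auto
  with Cons show ?case by (simp add: block_def)
qed simp

lemma last_blocks: "gs \<noteq> [] \<Longrightarrow> last (blocks gs)"
  by (induction gs rule: rev_induct) (auto simp: block_def)

text \<open>\<open>f\<close> is generalised in the induction because passing to a child prefixes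
  every path with one bit; the leaves are the nodes at depth \<open>k\<close>.\<close>

lemma leaf_pattern_complete_tree:
  assumes "\<And>p. Q (f p) \<longleftrightarrow> length p = k"
  shows "map Q (concat (preorder (complete_tree (\<lambda>p. [f p]) (Suc k)))) =
    blocks (Suc k # map ruler [1..<2 ^ k])"
  using assms
proof (induction k arbitrary: f)
  case 0
  then show ?case by (simp add: block_def)
next
  case (Suc k)
  have sub: "map Q (concat (preorder (complete_tree (\<lambda>p. [f (b # p)]) (Suc k)))) =
      blocks (Suc k # map ruler [1..<2 ^ k])" for b
    using Suc.prems by (intro Suc.IH) simp
  \<comment> \<open>The ruler sequence after index \<open>2 ^ k\<close> repeats its beginning, just
    as the right half of the tree repeats the left half.\<close>
  have right: "map (ruler \<circ> (+) (2 ^ k)) [1..<2 ^ k] = map ruler [1..<2 ^ k]"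
    by (auto simp: ruler_power2_add)
  have "map Q (concat (preorder (complete_tree (\<lambda>p. [f p]) (Suc (Suc k))))) =
      False # blocks (Suc k # map ruler [1..<2 ^ k]) @ blocks (Suc k # map ruler [1..<2 ^ k])"
    using Suc.prems sub[of False] sub[of True]
    by (subst complete_tree.simps) (simp del: complete_tree.simps)
  also have "\<dots> = blocks (Suc (Suc k) # map ruler [1..<2 ^ Suc k])"
    unfolding upt_power2_Suc list.map map_append map_map right
    by (simp add: block_def)
  finally show ?case .
qed

lemma Leaf_eq_complete_tree_iff: "\<langle>\<rangle> = complete_tree f k \<longleftrightarrow> k = 0"
  by (cases k) auto

text \<open>Separates the root (empty path) from the two children (first bit of the path).\<close>

lemma ex_list_split: "(\<exists>xs. P xs) \<longleftrightarrow> P [] \<or> (\<exists>x xs. P (x # xs))"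
  by (auto, metis neq_Nil_conv)

lemma leaf_in_subtrees_complete_tree:
  "\<langle>\<langle>\<rangle>, x, \<langle>\<rangle>\<rangle> \<in> subtrees (complete_tree f k) \<longleftrightarrow> (\<exists>p. Suc (length p) = k \<and> x = f p)"
proof (induction k arbitrary: f)
  case (Suc k)
  show ?case
    by (subst ex_list_split, simp add: Suc.IH Leaf_eq_complete_tree_iff ex_bool_eq) auto
qed simp

lemma leaf_in_subtrees_F_upto:
  "\<langle>\<langle>\<rangle>, [v], \<langle>\<rangle>\<rangle> \<in> subtrees (F_upto s h) \<longleftrightarrow>
    v = Initial \<or> (\<exists>k p. k < h \<and> length p = k \<and> v = Sub (Suc k) p)"
proof (induction h)
  case (Suc h)
  \<comment> \<open>A nonempty left child keeps a super-node from matching the leaf pattern, even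
    when its list is a singleton.\<close>
  have "F_upto s h \<noteq> \<langle>\<rangle>"
    by (cases h) auto
  then have "\<langle>\<langle>\<rangle>, [v], \<langle>\<rangle>\<rangle> \<in> subtrees (F_upto s (Suc h)) \<longleftrightarrow>
      \<langle>\<langle>\<rangle>, [v], \<langle>\<rangle>\<rangle> \<in> subtrees (F_upto s h) \<or> (\<exists>p. length p = h \<and> v = Sub (Suc h) p)"
    using leaf_in_subtrees_complete_tree[of "[v]" "\<lambda>p. [Sub (Suc h) p]" "Suc h"]
    by (auto simp: subtree_def simp del: complete_tree.simps)
  then show ?case
    unfolding Suc.IH by (auto simp: less_Suc_eq)
qed auto

lemma is_leaf_simps [simp]:
  "is_leaf s Initial" "\<not> is_leaf s (Super h i)" "is_leaf s (Sub (Suc k) p) \<longleftrightarrow> length p = k"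
  unfolding is_leaf_def leaf_in_subtrees_F_upto by auto

definition gap :: "nat \<Rightarrow> nat \<Rightarrow> nat" where
  "gap s n = ruler n + s * of_bool (\<exists>k. n = 2 ^ k)"

lemma gap_pos: "gap s n > 0"
  by (simp add: gap_def ruler_def)

lemma leaf_pattern_label_order:
  "map (is_leaf s) (label_order s h) = blocks (1 # map (gap s) [1..<2 ^ h])"
proof (induction h)
  case 0
  then show ?case by (simp add: block_def)
next
  case (Suc h)
  have sub: "map (is_leaf s) (concat (preorder (subtree (Suc h)))) =
      block (Suc h) @ blocks (map ruler [1..<2 ^ h])"
    unfolding subtree_def by (subst leaf_pattern_complete_tree) auto
  have super: "map (is_leaf s) (supernode s (Suc h)) = replicate s False"
    by (simp add: supernode_def o_def map_replicate_const)
  \<comment> \<open>The \<open>s\<close> super-node entries are all \<open>False\<close>, so they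
    merge into the first block of the subtree that follows.\<close>
  have first: "block (gap s (2 ^ h)) = replicate s False @ block (Suc h)"
    by (simp add: gap_def replicate_append_block add.commute)
  have rest: "map (gap s \<circ> (+) (2 ^ h)) [1..<2 ^ h] = map ruler [1..<2 ^ h]"
    by (auto simp: gap_def ruler_power2_add power2_add_not_power2)
  show ?case
    unfolding upt_power2_Suc list.map map_append map_map rest label_order.simps sub super Suc.IH
    by (simp add: first)
qed

lemma d_seq_eq_leaf_pattern:
  assumes "1 \<le> j" "j \<le> length (label_order s h)"
  shows "d_seq s j = of_bool (map (is_leaf s) (label_order s h) ! (j - 1))"
  using assms by (simp add: d_seq_def labelled_node_eq)

lemma a_seq_eq_count_list:
  assumes "j \<le> length (label_order s h)"
  shows "a_seq s j = count_list (take j (map (is_leaf s) (label_order s h))) True"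
  using assms
proof (induction j)
  case 0
  then show ?case by (simp add: a_seq_def)
next
  case (Suc j)
  then show ?case
    by (simp add: a_seq_def d_seq_eq_leaf_pattern[of _ s h] take_Suc_conv_app_nth)
qed

text \<open>\<open>a_seq\<close> is monotone and increases at \<open>j\<close>, so no earlier index
  reaches the value \<open>n\<close>.\<close>

lemma p_seq_eqI:
  assumes "1 \<le> j" "a_seq s j = n" "d_seq s j = 1"
  shows "p_seq s n = j"
  unfolding p_seq_def
proof (rule Least_equality)
  fix i assume i: "1 \<le> i \<and> a_seq s i = n"
  show "j \<le> i"
  proof (rule ccontr)
    assume "\<not> j \<le> i"
    then have "a_seq s i \<le> a_seq s (j - 1)"
      unfolding a_seq_def by (intro sum_mono2) auto
    also have "\<dots> < a_seq s j"
      using assms by (cases j) (simp_all add: a_seq_def)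
    finally show False using i assms by simp
  qed
qed (use assms in auto)

text \<open>The leading 1 is the label of the initial node, the first leaf.\<close>

lemma p_seq_Suc: "p_seq s (Suc n) = 1 + (\<Sum>i=1..n. gap s i)"
proof (rule p_seq_eqI)
  let ?gs = "1 # map (gap s) [1..<Suc n]"
  let ?p = "1 + (\<Sum>i=1..n. gap s i)"
  \<comment> \<open>Height \<open>Suc n\<close> suffices because \<open>Suc n < 2 ^ Suc n\<close>,
    so the first \<open>n\<close> gaps all occur in the finite pattern.\<close>
  obtain vs where vs: "[1..<2 ^ Suc n] = [1..<Suc n] @ vs"
    using upt_add_eq_append[of 1 "Suc n" "2 ^ Suc n - Suc n"] less_exp[of "Suc n"]
    by (metis le_add_diff_inverse less_imp_le_nat plus_1_eq_Suc le_add1)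
  have pat: "map (is_leaf s) (label_order s (Suc n)) = blocks ?gs @ blocks (map (gap s) vs)"
    unfolding leaf_pattern_label_order vs by simp
  have "length (blocks ?gs) = sum_list ?gs"
    by (intro length_blocks) (simp add: gap_pos)
  also have "\<dots> = ?p"
    by (simp add: interv_sum_list_conv_sum_set_nat atLeastLessThanSuc_atLeastAtMost del: upt_Suc)
  finally have len: "length (blocks ?gs) = ?p" .
  have le: "?p \<le> length (label_order s (Suc n))"
    using arg_cong[OF pat, of length] len by simp
  show "1 \<le> ?p" by simp
  show "a_seq s ?p = Suc n"
    unfolding a_seq_eq_count_list[OF le] pat
    using count_list_blocks[of ?gs] len by simp
  \<comment> \<open>Every block ends in \<open>True\<close>, so the last entry of the prefix is a
    leaf; labels start at 1 and list indices at 0, hence \<open>?p - 1\<close>.\<close>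
  have "blocks ?gs \<noteq> []"
    by (simp add: block_def)
  then have "blocks ?gs ! (?p - 1)"
    using last_blocks[of ?gs] unfolding len[symmetric] by (simp add: last_conv_nth)
  moreover have "?p - 1 < length (blocks ?gs)"
    unfolding len by simp
  ultimately show "d_seq s ?p = 1"
    unfolding d_seq_eq_leaf_pattern[OF \<open>1 \<le> ?p\<close> le] pat
    by (simp only: nth_append if_True of_bool_eq)
qed

theorem corollary2p9:
  fixes s n :: nat
  assumes "n \<ge> 1"
  shows "int (p_seq s (n + 1)) - int (p_seq s n) = int (ruler n) + int s * of_bool (\<exists>k. n = 2 ^ k)"
proof -
  obtain m where n: "n = Suc m"
    using assms by (cases n) auto
  have "p_seq s (Suc n) = p_seq s n + gap s n"
    unfolding n p_seq_Suc by simp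
  then show ?thesis
    by (simp add: gap_def)
qed

end
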